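(* Let $\mathcal{G}=(V,(V_1,V_2,V_P),\delta)$ be a stochastic game that is stopping under fairness, with $T$ its set of terminal vertices. Let $\pi_1$ be any Player 1 strategy and $\pi_2$ a memoryless fair Player 2 strategy. Then for every $v\in V$, $\sum_{N=0}^{\infty}\sum_{\hat\omega\in v(V\setminus T)^N}\Pr^{\pi_1,\pi_2}_{\mathcal{G},v}(\hat\omega)<\infty$, where $v(V\setminus T)^N$ denotes the set of finite sequences consisting of $v$ followed by $N$ vertices of $V\setminus T$.
   Context: A stochastic game is a tuple $\mathcal{G}=(V,(V_1,V_2,V_P),\delta)$ where $V$ is a finite set of vertices, $V_1,V_2,V_P$ form a partition of $V$, and $\delta:V\times V\to[0,1]$ satisfies $\delta(v,v')\in\{0,1\}$ for $v\in V_1\cup V_2$, $v'\in V$, and $\delta(v,\cdot)$ is a probability distribution on $V$ for $v\in V_P$. Let $\mathrm{post}(v)=\{v'\mid \delta(v,v')>0\}$; it is assumed $\mathrm{post}(v)\neq\emptyset$ for all $v$. A vertex $v$ is terminal if $\delta(v,v)=1$ and $\delta(v,v')=0$ for $v'\neq v$. A path is an infinite sequence $\omega=v_0v_1\dots$ with $\delta(v_k,v_{k+1})>0$ for all $k$; $\inf(\omega)$ is the set of vertices occurring infinitely often in $\omega$. A strategy for Player $i\in\{1,2\}$ is a function $\pi_i:V^*V_i\to\mathcal{D}(V)$ with $\pi_i(\hat\omega u)(u')>0$ only if $u'\in\mathrm{post}(u)$; it is memoryless if $\pi_i(\hat\omega u)$ depends only on $u$. Given strategies $\pi_1,\pi_2$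 and initial vertex $v$, $\Pr^{\pi_1,\pi_2}_{\mathcal{G},v}$ is the induced probability measure on paths starting at $v$; for a finite sequence $\hat\omega$, $\Pr^{\pi_1,\pi_2}_{\mathcal{G},v}(\hat\omega)$ is the probability of the set of paths having $\hat\omega$ as a prefix. $\Diamond T$ is the set of paths visiting $T$. Fair plays: $FP^2=\{\omega\mid \forall v'\in V_2:\ v'\in\inf(\omega)\Rightarrow \mathrm{post}(v')\subseteq\inf(\omega)\}$; a Player 2 strategy $\pi_2$ is fair if $\Pr^{\pi_1,\pi_2}_{\mathcal{G},u}(FP^2)=1$ for every Player 1 strategy $\pi_1$ and every $u\in V$. $\mathcal{G}$ is stopping under fairness if $\Pr^{\pi_1,\pi_2}_{\mathcal{G},u}(\Diamond T)=1$ for all Player 1 strategies $\pi_1$, all fair Player 2 strategies $\pi_2$, and all $u\in V$. *)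

theory Defs
  imports "HOL-Probability.Probability"
begin

text \<open>The finite vertex set is rendered as a type of class \<open>finite\<close>, so \<open>V\<close> is \<^term>\<open>UNIV\<close>.\<close>

record 'v game =
  V1 :: "'v set"
  V2 :: "'v set"
  VP :: "'v set"
  delta :: "'v \<Rightarrow> 'v \<Rightarrow> real"

definition post :: "'v game \<Rightarrow> 'v \<Rightarrow> 'v set" where
  "post G v = {v'. delta G v v' > 0}"

definition stochastic_game :: "'v::finite game \<Rightarrow> bool" where
  "stochastic_game G \<longleftrightarrow>
     V1 G \<union> V2 G \<union> VP G = UNIV \<and>
     V1 G \<inter> V2 G = {} \<and> V1 G \<inter> VP G = {} \<and> V2 G \<inter> VP G = {} \<and>
     (\<forall>v v'. 0 \<le> delta G v v' \<and> delta G v v' \<le> 1) \<and>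
     (\<forall>v \<in> V1 G \<union> V2 G. \<forall>v'. delta G v v' \<in> {0, 1}) \<and>
     (\<forall>v \<in> VP G. (\<Sum>v'\<in>UNIV. delta G v v') = 1) \<and>
     (\<forall>v. post G v \<noteq> {})"

definition terminal :: "'v game \<Rightarrow> 'v \<Rightarrow> bool" where
  "terminal G v \<longleftrightarrow> delta G v v = 1 \<and> (\<forall>v'. v' \<noteq> v \<longrightarrow> delta G v v' = 0)"

definition terminals :: "'v game \<Rightarrow> 'v set" where
  "terminals G = {v. terminal G v}"

definition paths :: "'v game \<Rightarrow> (nat \<Rightarrow> 'v) set" where
  "paths G = {\<omega>. \<forall>k. delta G (\<omega> k) (\<omega> (Suc k)) > 0}"

definition inf_set :: "(nat \<Rightarrow> 'v) \<Rightarrow> 'v set" where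
  "inf_set \<omega> = {v. \<exists>\<^sub>\<infinity>k. \<omega> k = v}"

text \<open>A strategy maps a nonempty history, oldest vertex first, to a distribution over vertices.
  It is a total function on lists; only its values on histories ending in the vertex set
  \<open>W\<close> of the respective player are constrained, and only these are used by the plays below.\<close>

type_synonym 'v strategy = "'v list \<Rightarrow> 'v pmf"

definition strategy_for :: "'v game \<Rightarrow> 'v set \<Rightarrow> 'v strategy \<Rightarrow> bool" where
  "strategy_for G W \<pi> \<longleftrightarrow> (\<forall>h. \<forall>u \<in> W. \<forall>u'. pmf (\<pi> (h @ [u])) u' > 0 \<longrightarrow> u' \<in> post G u)"

abbreviation strategy1 :: "'v game \<Rightarrow> 'v strategy \<Rightarrow> bool" where
  "strategy1 G \<equiv> strategy_for G (V1 G)"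

abbreviation strategy2 :: "'v game \<Rightarrow> 'v strategy \<Rightarrow> bool" where
  "strategy2 G \<equiv> strategy_for G (V2 G)"

definition memoryless :: "'v set \<Rightarrow> 'v strategy \<Rightarrow> bool" where
  "memoryless W \<pi> \<longleftrightarrow> (\<forall>h h'. \<forall>u \<in> W. \<pi> (h @ [u]) = \<pi> (h' @ [u]))"

definition next_vertex :: "'v game \<Rightarrow> 'v strategy \<Rightarrow> 'v strategy \<Rightarrow> 'v list \<Rightarrow> 'v pmf" where
  "next_vertex G \<pi>1 \<pi>2 h =
     (if last h \<in> V1 G then \<pi>1 h
      else if last h \<in> V2 G then \<pi>2 h
      else embed_pmf (delta G (last h)))"

text \<open>Distribution of the vertex at position \<open>i\<close>, given the vertices at the positions below \<open>i\<close>.\<close>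

definition play_kernel ::
  "'v game \<Rightarrow> 'v strategy \<Rightarrow> 'v strategy \<Rightarrow> 'v \<Rightarrow> nat \<Rightarrow> (nat \<Rightarrow> 'v) \<Rightarrow> 'v pmf" where
  "play_kernel G \<pi>1 \<pi>2 v i \<omega> =
     (if i = 0 then return_pmf v else next_vertex G \<pi>1 \<pi>2 (map \<omega> [0..<i]))"

text \<open>The measure induced on infinite vertex sequences (Ionescu-Tulcea). The locale assumptions
  and the resulting cylinder probabilities are established below.\<close>

definition play_measure ::
  "'v::finite game \<Rightarrow> 'v strategy \<Rightarrow> 'v strategy \<Rightarrow> 'v \<Rightarrow> (nat \<Rightarrow> 'v) measure" where
  "play_measure G \<pi>1 \<pi>2 v =
     projective_family.lim UNIV
       (Ionescu_Tulcea.CI (\<lambda>i \<omega>. measure_pmf (play_kernel G \<pi>1 \<pi>2 v i \<omega>)) (\<lambda>_. count_space UNIV))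
       (\<lambda>_. count_space UNIV)"

definition reaching :: "'v game \<Rightarrow> 'v set \<Rightarrow> (nat \<Rightarrow> 'v) set" where
  "reaching G T = {\<omega> \<in> paths G. \<exists>k. \<omega> k \<in> T}"

definition cylinder :: "'v game \<Rightarrow> 'v list \<Rightarrow> (nat \<Rightarrow> 'v) set" where
  "cylinder G h = {\<omega> \<in> paths G. \<forall>i < length h. \<omega> i = h ! i}"

definition fair_plays2 :: "'v game \<Rightarrow> (nat \<Rightarrow> 'v) set" where
  "fair_plays2 G = {\<omega> \<in> paths G. \<forall>v' \<in> V2 G. v' \<in> inf_set \<omega> \<longrightarrow> post G v' \<subseteq> inf_set \<omega>}"

definition fair2 :: "'v::finite game \<Rightarrow> 'v strategy \<Rightarrow> bool" where
  "fair2 G \<pi>2 \<longleftrightarrow>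
     (\<forall>\<pi>1 u. strategy1 G \<pi>1 \<longrightarrow> emeasure (play_measure G \<pi>1 \<pi>2 u) (fair_plays2 G) = 1)"

definition stopping_under_fairness :: "'v::finite game \<Rightarrow> bool" where
  "stopping_under_fairness G \<longleftrightarrow>
     (\<forall>\<pi>1 \<pi>2 u. strategy1 G \<pi>1 \<longrightarrow> strategy2 G \<pi>2 \<longrightarrow> fair2 G \<pi>2 \<longrightarrow>
        emeasure (play_measure G \<pi>1 \<pi>2 u) (reaching G (terminals G)) = 1)"

lemma PiM_count_space_finite:
  assumes "finite J"
  shows "PiM J (\<lambda>_. count_space (UNIV :: 'v::finite set)) = count_space (PiE J (\<lambda>_. UNIV))"
  using assms by (intro count_space_PiM_finite) auto

lemma Ionescu_Tulcea_play:
  "Ionescu_Tulcea (\<lambda>i \<omega>. measure_pmf (play_kernel G \<pi>1 \<pi>2 v i \<omega>))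
     (\<lambda>_. count_space (UNIV :: 'v::finite set))"
  by unfold_locales
    (auto simp: PiM_count_space_finite space_subprob_algebra
       measure_pmf.subprob_space_axioms measure_pmf.prob_space_axioms)

lemma space_play_measure: "space (play_measure G \<pi>1 \<pi>2 v) = UNIV"
proof -
  interpret Ionescu_Tulcea "\<lambda>i \<omega>. measure_pmf (play_kernel G \<pi>1 \<pi>2 v i \<omega>)" "\<lambda>_. count_space UNIV"
    by (rule Ionescu_Tulcea_play)
  show ?thesis by (simp add: play_measure_def PF.space_lim space_PiM)
qed

lemma sets_play_measure:
  "sets (play_measure G \<pi>1 \<pi>2 v) = sets (PiM UNIV (\<lambda>_. count_space UNIV))"
proof -
  interpret Ionescu_Tulcea "\<lambda>i \<omega>. measure_pmf (play_kernel G \<pi>1 \<pi>2 v i \<omega>)" "\<lambda>_. count_space UNIV"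
    by (rule Ionescu_Tulcea_play)
  show ?thesis by (simp add: play_measure_def PF.sets_lim)
qed

lemma emeasure_play_measure_prefix:
  "emeasure (play_measure G \<pi>1 \<pi>2 v) {\<omega>. \<forall>i < length h. \<omega> i = h ! i} =
     (\<Prod>i < length h. ennreal (pmf (play_kernel G \<pi>1 \<pi>2 v i (\<lambda>j. h ! j)) (h ! i)))"
proof -
  let ?M = "\<lambda>_::nat. count_space (UNIV :: 'a set)"
  let ?K = "play_kernel G \<pi>1 \<pi>2 v"
  interpret Ionescu_Tulcea "\<lambda>i \<omega>. measure_pmf (?K i \<omega>)" ?M
    by (rule Ionescu_Tulcea_play)
  have K: "?K i (restrict \<omega> {0..<i}) = ?K i \<omega>" for i \<omega>
  proof -
    have "map (restrict \<omega> {0..<i}) [0..<i] = map \<omega> [0..<i]"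
      by (intro map_cong) auto
    then show ?thesis by (simp only: play_kernel_def)
  qed
  have E: "sets (PiM {0..<n} ?M) = Pow (PiE {0..<n} (\<lambda>_. UNIV))" for n
    by (simp add: PiM_count_space_finite)
  have S: "space (PiM {0..<n} ?M) = PiE {0..<n} (\<lambda>_. UNIV)" for n
    by (simp add: space_PiM)
  have C: "emeasure (C 0 n (\<lambda>_. undefined)) {restrict x {0..<n}} = (\<Prod>i<n. ennreal (pmf (?K i x) (x i)))" for n x
  proof (induction n)
    case 0
    show ?case by (simp add: restrict_def PiM_empty)
  next
    case (Suc n)
    let ?r = "restrict x {0..<n}" and ?R = "restrict x {0..<Suc n}"
    have r: "?r \<in> space (PiM {0..<n} ?M)" by (simp add: S)
    have R: "{?R} \<in> sets (PiM {0..<Suc n} ?M)" by (simp add: E)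
    have u: "(\<lambda>_. undefined) \<in> space (PiM {0..<0} ?M)" by (simp add: space_PiM PiE_def extensional_def)
    have e: "emeasure (eP n y) {?R} = ennreal (pmf (?K n x) (x n)) * indicator {?r} y"
      if y: "y \<in> space (PiM {0..<n} ?M)" for y
    proof -
      have "emeasure (eP n y) {?R} = emeasure (measure_pmf (?K n y)) ((\<lambda>a. y(n := a)) -` {?R} \<inter> UNIV)"
        using emeasure_eP[OF y R] by simp
      also have "(\<lambda>a. y(n := a)) -` {?R} \<inter> UNIV = (if y = ?r then {x n} else {})"
      proof -
        have yn: "y i = undefined" if "\<not> i < n" for i
          using y that by (auto simp: S PiE_def extensional_def)
        have "y(n := a) = ?R \<longleftrightarrow> y = ?r \<and> a = x n" for a
          using yn unfolding fun_eq_iff by (auto simp: less_Suc_eq)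
        then show ?thesis by auto
      qed
      finally show ?thesis
        using K[of n x] by (cases "y = ?r") (simp_all add: emeasure_pmf_single del: restrict_apply)
    qed
    have "emeasure (C 0 (Suc n) (\<lambda>_. undefined)) {?R} =
        (\<integral>\<^sup>+y. emeasure (eP n y) {?R} \<partial>C 0 n (\<lambda>_. undefined))"
      using measurable_eP[of n] R u
      by (simp, intro emeasure_bind[where N="PiM {0..<Suc n} ?M"])
         (auto simp: space_C S measurable_cong_sets[OF sets_C[OF u] refl])
    also have "\<dots> = (\<integral>\<^sup>+y. ennreal (pmf (?K n x) (x n)) * indicator {?r} y \<partial>C 0 n (\<lambda>_. undefined))"
      using u by (intro nn_integral_cong e) (auto simp: space_C)
    also have "\<dots> = ennreal (pmf (?K n x) (x n)) * emeasure (C 0 n (\<lambda>_. undefined)) {?r}"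
      using u by (intro nn_integral_cmult_indicator) (simp add: sets_C E)
    finally show ?case unfolding Suc.IH by (simp add: mult.commute del: restrict_apply C.simps)
  qed
  let ?n = "length h" and ?x = "restrict (\<lambda>j. h ! j) {0..<length h}"
  have restr: "restrict \<omega> {0..<?n} = ?x \<longleftrightarrow> (\<forall>i < ?n. \<omega> i = h ! i)" for \<omega>
  proof
    assume "restrict \<omega> {0..<?n} = ?x"
    then have "restrict \<omega> {0..<?n} i = ?x i" for i by (rule fun_cong)
    then show "\<forall>i < ?n. \<omega> i = h ! i" by (metis restrict_apply' atLeastLessThan_iff zero_le)
  next
    assume "\<forall>i < ?n. \<omega> i = h ! i"
    then show "restrict \<omega> {0..<?n} = ?x" by (intro restrict_ext) simp
  qed
  have "PF.emb UNIV {0..<?n} {?x} = {\<omega>. restrict \<omega> {0..<?n} = ?x}"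
    by (auto simp: prod_emb_def space_PiM simp del: restrict_apply)
  then have "{\<omega>. \<forall>i < length h. \<omega> i = h ! i} = PF.emb UNIV {0..<?n} {?x}"
    by (simp only: restr)
  then have "emeasure (play_measure G \<pi>1 \<pi>2 v) {\<omega>. \<forall>i < length h. \<omega> i = h ! i} = emeasure (CI {0..<?n}) {?x}"
    unfolding play_measure_def by (simp add: lim E)
  also have "\<dots> = emeasure (C 0 ?n (\<lambda>_. undefined)) (PF.emb {0..<?n} {0..<?n} {?x})"
    by (intro emeasure_CI) (auto simp: E)
  also have "PF.emb {0..<?n} {0..<?n} {?x} = {?x}"
    by (auto simp: prod_emb_def S)
  finally show ?thesis using C by simp
qed

end

theory Submission
  imports Defs
begin

text \<open>Since Player 2 is memoryless, only Player 1 has to be controlled. Call a vertex transient if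
  there are a horizon \<open>n\<close> and an \<open>\<epsilon> > 0\<close> such that, after every history ending in that vertex, the
  play avoids the terminals for \<open>n\<close> further steps with probability at most \<open>1 - \<epsilon>\<close>. A random or
  Player 2 vertex with a transient successor is transient, and so is a Player 1 vertex all of whose
  successors are transient. Hence the vertices that are not transient form a trap in which a
  memoryless Player 1 strategy could keep the play forever; stopping under fairness rules this out.
  So all vertices are transient, uniformly as there are finitely many of them, and the survival
  probabilities decay geometrically.\<close>

section \<open>Survival probabilities of a history-dependent kernel\<close>

text \<open>The probability that the next \<open>n\<close> vertices drawn after \<open>h\<close> all
  lie in \<open>S\<close>; the vertices of \<open>h\<close> itself are not tested. Recursion on the
  first step allows finite sums in place of the measure on infinite plays.\<close>

fun survival :: "('v list \<Rightarrow> 'v pmf) \<Rightarrow> 'v::finite set \<Rightarrow> nat \<Rightarrow> 'v list \<Rightarrow> real" where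
  "survival K S 0 h = 1"
| "survival K S (Suc n) h = (\<Sum>a\<in>S. pmf (K h) a * survival K S n (h @ [a]))"

lemma sum_pmf_UNIV: "(\<Sum>a\<in>UNIV. pmf p a) = (1 :: real)" for p :: "'v::finite pmf"
  by (rule sum_pmf_eq_1) auto

lemma survival_nonneg: "0 \<le> survival K S n h"
  by (induction n arbitrary: h) (auto intro!: sum_nonneg)

lemma survival_Suc_le_UNIV:
  "survival K S (Suc n) h \<le> (\<Sum>a\<in>UNIV. pmf (K h) a * survival K S n (h @ [a]))"
  by (auto intro!: sum_mono2 mult_nonneg_nonneg survival_nonneg)

lemma survival_le_1: "survival K S n h \<le> 1"
proof (induction n arbitrary: h)
  case (Suc n)
  have "survival K S (Suc n) h \<le> (\<Sum>a\<in>UNIV. pmf (K h) a * survival K S n (h @ [a]))"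
    by (rule survival_Suc_le_UNIV)
  also have "\<dots> \<le> (\<Sum>a\<in>UNIV. pmf (K h) a)"
    using Suc.IH by (intro sum_mono mult_left_le) auto
  finally show ?case by (simp add: sum_pmf_UNIV)
qed simp

lemma survival_Suc_le: "survival K S (Suc n) h \<le> survival K S n h"
proof (induction n arbitrary: h)
  case 0
  show ?case using survival_le_1[of K S "Suc 0" h] by simp
next
  case (Suc n)
  have "survival K S (Suc (Suc n)) h = (\<Sum>a\<in>S. pmf (K h) a * survival K S (Suc n) (h @ [a]))"
    by (rule survival.simps)
  also have "\<dots> \<le> (\<Sum>a\<in>S. pmf (K h) a * survival K S n (h @ [a]))"
    by (intro sum_mono mult_left_mono Suc.IH) auto
  finally show ?case by simp
qed

lemma survival_antimono: "m \<le> n \<Longrightarrow> survival K S n h \<le> survival K S m h"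
  using lift_Suc_antimono_le[of "\<lambda>n. survival K S n h"] survival_Suc_le by blast

text \<open>After \<open>n\<close> steps the history is still nonempty, so the bound
  \<open>c\<close>, uniform over such histories, applies to the last \<open>m\<close> steps.\<close>

lemma survival_add_le:
  assumes "\<And>h u. survival K S m (h @ [u]) \<le> c"
  shows "survival K S (n + m) (h @ [u]) \<le> c * survival K S n (h @ [u])"
proof (induction n arbitrary: h u)
  case 0
  show ?case using assms by simp
next
  case (Suc n)
  have "survival K S (Suc n + m) (h @ [u])
      = (\<Sum>a\<in>S. pmf (K (h @ [u])) a * survival K S (n + m) ((h @ [u]) @ [a]))"
    by simp
  also have "\<dots> \<le> (\<Sum>a\<in>S. pmf (K (h @ [u])) a * (c * survival K S n ((h @ [u]) @ [a])))"
    by (intro sum_mono mult_left_mono Suc.IH) auto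
  also have "\<dots> = c * survival K S (Suc n) (h @ [u])"
    by (simp add: sum_distrib_left mult_ac)
  finally show ?case .
qed

text \<open>Unrolls the recursion into one product per word, the form in which prefix probabilities
  of the play measure appear.\<close>

lemma survival_eq_sum_prod:
  "survival K S n h =
    (\<Sum>w | length w = n \<and> set w \<subseteq> S. \<Prod>i<n. pmf (K (h @ take i w)) (w ! i))"
proof (induction n arbitrary: h)
  case 0
  have "{w :: 'a list. length w = 0 \<and> set w \<subseteq> S} = {[]}" by auto
  then show ?case by simp
next
  case (Suc n)
  let ?L = "\<lambda>n. {w. length w = n \<and> set w \<subseteq> S}"
  have L: "?L (Suc n) = (\<lambda>(a, w). a # w) ` (S \<times> ?L n)"
    by (auto simp: length_Suc_conv)
  have "(\<Sum>w\<in>?L (Suc n). \<Prod>i<Suc n. pmf (K (h @ take i w)) (w ! i))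
      = (\<Sum>(a, w)\<in>S \<times> ?L n. pmf (K h) a * (\<Prod>i<n. pmf (K ((h @ [a]) @ take i w)) (w ! i)))"
    unfolding L
    by (subst sum.reindex) (auto intro!: sum.cong inj_onI simp: prod.lessThan_Suc_shift simp del: prod.lessThan_Suc)
  also have "\<dots> = survival K S (Suc n) h"
    by (simp add: Suc.IH sum.cartesian_product sum_distrib_left)
  finally show ?case by simp
qed

section \<open>Transient vertices\<close>

definition transient :: "('v list \<Rightarrow> 'v pmf) \<Rightarrow> 'v::finite set \<Rightarrow> 'v \<Rightarrow> bool" where
  "transient K S u \<longleftrightarrow> (\<exists>n. \<exists>\<epsilon>>0. \<forall>h. survival K S n (h @ [u]) \<le> 1 - \<epsilon>)"

text \<open>Survival decreases with the horizon, so the largest horizon and the smallest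
  \<open>\<epsilon>\<close> serve all of the finite set.\<close>

lemma transient_uniform:
  fixes B :: "'v::finite set"
  assumes "\<forall>u\<in>B. transient K S u"
  shows "\<exists>n. \<exists>\<epsilon>>0. \<forall>u\<in>B. \<forall>h. survival K S n (h @ [u]) \<le> 1 - \<epsilon>"
  using finite[of B] assms
proof (induction B rule: finite_induct)
  case empty
  show ?case by (auto intro: exI[of _ 1])
next
  case (insert x B)
  obtain n \<epsilon> where 1: "\<epsilon> > 0" "\<forall>u\<in>B. \<forall>h. survival K S n (h @ [u]) \<le> 1 - \<epsilon>"
    using insert by auto
  obtain m \<delta> where 2: "\<delta> > 0" "\<forall>h. survival K S m (h @ [x]) \<le> 1 - \<delta>"
    using insert.prems by (auto simp: transient_def)
  have "survival K S (max m n) (h @ [u]) \<le> 1 - min \<delta> \<epsilon>" if "u \<in> insert x B" for h u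
  proof (cases "u = x")
    case True
    then show ?thesis
      using 2(2)[rule_format, of h] survival_antimono[of m "max m n" K S "h @ [u]"] by simp
  next
    case False
    then have "survival K S n (h @ [u]) \<le> 1 - \<epsilon>" using 1(2) that by blast
    then show ?thesis
      using survival_antimono[of n "max m n" K S "h @ [u]"] by simp
  qed
  then show ?case using 1(1) 2(1)
    by (intro exI[of _ "max m n"] exI[of _ "min \<delta> \<epsilon>"]) auto
qed

text \<open>However the first step is distributed, it lands in \<open>B\<close>, and an average of
  values at most \<open>1 - \<epsilon>\<close> is at most \<open>1 - \<epsilon>\<close>. This covers
  Player 1 vertices, where the choice may vary with the history.\<close>

lemma transient_if_successors_transient:
  assumes B: "\<forall>b\<in>B. transient K S b" and supp: "\<And>h. set_pmf (K (h @ [u])) \<subseteq> B"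
  shows "transient K S u"
proof -
  obtain n \<epsilon> where e: "\<epsilon> > 0" "\<forall>b\<in>B. \<forall>h. survival K S n (h @ [b]) \<le> 1 - \<epsilon>"
    using transient_uniform[OF B] by blast
  have "survival K S (Suc n) (h @ [u]) \<le> 1 - \<epsilon>" for h
  proof -
    have "survival K S (Suc n) (h @ [u])
        \<le> (\<Sum>a\<in>UNIV. pmf (K (h @ [u])) a * survival K S n ((h @ [u]) @ [a]))"
      by (rule survival_Suc_le_UNIV)
    also have "\<dots> \<le> (\<Sum>a\<in>UNIV. pmf (K (h @ [u])) a * (1 - \<epsilon>))"
    proof (rule sum_mono)
      fix a
      show "pmf (K (h @ [u])) a * survival K S n ((h @ [u]) @ [a]) \<le> pmf (K (h @ [u])) a * (1 - \<epsilon>)"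
      proof (cases "a \<in> set_pmf (K (h @ [u]))")
        case True
        then have "a \<in> B" using supp by blast
        then show ?thesis by (intro mult_left_mono e(2)[rule_format]) auto
      qed (simp add: set_pmf_iff)
    qed
    also have "\<dots> = 1 - \<epsilon>" by (simp add: sum_pmf_UNIV flip: sum_distrib_right)
    finally show ?thesis .
  qed
  then show ?thesis using e(1) unfolding transient_def by blast
qed

text \<open>The step to \<open>b\<close> alone lowers survival by at least
  \<open>p * \<epsilon>\<close>. The bound \<open>p\<close> must not depend on the history, which
  random vertices and a memoryless Player 2 guarantee.\<close>

lemma transient_if_successor_transient:
  assumes b: "transient K S b" and p: "p > 0" "\<And>h. pmf (K (h @ [u])) b \<ge> p"
  shows "transient K S u"
proof -
  obtain n \<epsilon> where e: "\<epsilon> > 0" "\<And>h. survival K S n (h @ [b]) \<le> 1 - \<epsilon>"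
    using b unfolding transient_def by blast
  have "survival K S (Suc n) (h @ [u]) \<le> 1 - p * \<epsilon>" for h
  proof -
    let ?p = "pmf (K (h @ [u]))"
    have "survival K S (Suc n) (h @ [u]) \<le> (\<Sum>a\<in>UNIV. ?p a * survival K S n ((h @ [u]) @ [a]))"
      by (rule survival_Suc_le_UNIV)
    \<comment> \<open>Successors other than \<open>b\<close> get the trivial survival bound
      1.\<close>
    also have "\<dots> \<le> (\<Sum>a\<in>UNIV. ?p a - (if a = b then ?p b * \<epsilon> else 0))"
    proof (rule sum_mono)
      fix a
      show "?p a * survival K S n ((h @ [u]) @ [a]) \<le> ?p a - (if a = b then ?p b * \<epsilon> else 0)"
        using mult_left_mono[OF e(2)[of "h @ [u]"], of "?p b"]
          mult_left_le[OF survival_le_1[of K S n "(h @ [u]) @ [a]"], of "?p a"]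
        by (auto simp: algebra_simps)
    qed
    also have "\<dots> = 1 - ?p b * \<epsilon>" by (simp add: sum_subtractf sum_pmf_UNIV)
    also have "\<dots> \<le> 1 - p * \<epsilon>" using p(2)[of h] e(1) by simp
    finally show ?thesis .
  qed
  moreover have "p * \<epsilon> > 0" using e(1) p(1) by simp
  ultimately show ?thesis unfolding transient_def by blast
qed

text \<open>A partial sum \<open>X\<close> satisfies
  \<open>X \<le> m + (1 - \<epsilon>) * X\<close>: the first \<open>m\<close> terms are at most 1
  each, and the others are compared with the terms \<open>m\<close> places earlier. Hence
  \<open>X \<le> m / \<epsilon>\<close>.\<close>

lemma summable_survival:
  assumes "\<And>u. transient K S u"
  shows "summable (\<lambda>n. survival K S n [v])"
proof -
  obtain m \<epsilon> where e: "\<epsilon> > 0" "\<And>h u. survival K S m (h @ [u]) \<le> 1 - \<epsilon>"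
    using transient_uniform[of UNIV K S] assms by blast
  let ?s = "\<lambda>n. survival K S n [v]"
  have "(\<Sum>n<M. ?s n) \<le> m / \<epsilon>" for M
  proof -
    have "(\<Sum>n<M. ?s n) \<le> (\<Sum>n<m + M. ?s n)"
      by (intro sum_mono2) (auto simp: survival_nonneg)
    also have "\<dots> = (\<Sum>n<m. ?s n) + (\<Sum>n<M. ?s (n + m))"
      by (induction M) (auto simp: add_ac)
    also have "(\<Sum>n<m. ?s n) \<le> (\<Sum>n<m. 1)"
      by (intro sum_mono survival_le_1)
    also have "(\<Sum>n<M. ?s (n + m)) \<le> (\<Sum>n<M. (1 - \<epsilon>) * ?s n)"
      using survival_add_le[OF e(2), of _ "[]" v] by (intro sum_mono) simp
    finally have "\<epsilon> * (\<Sum>n<M. ?s n) \<le> m"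
      by (simp add: algebra_simps sum_subtractf flip: sum_distrib_left)
    then show ?thesis using e(1) by (simp add: field_simps)
  qed
  then show ?thesis
    by (intro bounded_imp_summable[where B = "m / \<epsilon>"] survival_nonneg)
      (metis lessThan_Suc_atMost)
qed

section \<open>Prefix events of the play measure\<close>

text \<open>The factor at position 0 is the point mass at \<open>v\<close> and equals 1; shifting
  the others by one gives the products of \<open>survival_eq_sum_prod\<close> for the history
  \<open>[v]\<close>.\<close>

lemma emeasure_play_measure_prefix_Cons:
  "emeasure (play_measure G \<pi>1 \<pi>2 v) {\<omega>. \<forall>i < length (v # w). \<omega> i = (v # w) ! i} =
     ennreal (\<Prod>i<length w. pmf (next_vertex G \<pi>1 \<pi>2 ([v] @ take i w)) (w ! i))"
proof -
  have m: "map (\<lambda>j. (v # w) ! j) [0..<Suc i] = [v] @ take i w" if "i < length w" for i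
    using that by (intro nth_equalityI) (auto simp: nth_Cons' simp del: upt_Suc)
  show ?thesis
    unfolding emeasure_play_measure_prefix
    by (simp add: prod.lessThan_Suc_shift play_kernel_def prod_ennreal m del: upt_Suc prod.lessThan_Suc)
qed

lemma prefix_sets_play_measure:
  "{\<omega>. \<forall>i < length h. \<omega> i = h ! i} \<in> sets (play_measure G \<pi>1 \<pi>2 v)"
proof -
  have "{\<omega> \<in> space (PiM UNIV (\<lambda>_. count_space UNIV)). \<forall>i < length h. \<omega> i = h ! i}
      \<in> sets (PiM UNIV (\<lambda>_. count_space (UNIV :: 'a set)))"
    by measurable
  then show ?thesis by (simp add: sets_play_measure space_PiM)
qed

text \<open>A finite prefix that starts at \<open>u\<close> and ends in \<open>B\<close> must
  somewhere step from outside \<open>B\<close> into \<open>B\<close>, which has probability 0.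
  Countably many such prefixes cover the event.\<close>

lemma reaching_null_if_trap:
  assumes u: "u \<notin> B" and T: "T \<subseteq> B"
    and trap: "\<And>h a b. a \<notin> B \<Longrightarrow> b \<in> B \<Longrightarrow> pmf (next_vertex G \<pi>1 \<pi>2 (h @ [a])) b = 0"
  shows "emeasure (play_measure G \<pi>1 \<pi>2 u) (reaching G T) = 0"
proof -
  let ?M = "play_measure G \<pi>1 \<pi>2 u"
  let ?P = "\<lambda>h. {\<omega>. \<forall>i < length h. \<omega> i = h ! i}"
  let ?H = "{h. h \<noteq> [] \<and> last h \<in> B}"
  have null: "?P h \<in> null_sets ?M" if "h \<in> ?H" for h
  proof -
    have "\<exists>i<length h. pmf (play_kernel G \<pi>1 \<pi>2 u i (\<lambda>j. h ! j)) (h ! i) = 0"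
    proof (rule ccontr)
      assume neg: "\<not> ?thesis"
      \<comment> \<open>If every factor were positive, the prefix would start at \<open>u\<close>
        and never enter \<open>B\<close>, against \<open>last h \<in> B\<close>.\<close>
      have "h ! i \<notin> B" if "i < length h" for i
        using that
      proof (induction i)
        case 0
        then show ?case using neg u by (auto simp: play_kernel_def indicator_def)
      next
        case (Suc i)
        have "play_kernel G \<pi>1 \<pi>2 u (Suc i) (\<lambda>j. h ! j)
            = next_vertex G \<pi>1 \<pi>2 (map (\<lambda>j. h ! j) [0..<i] @ [h ! i])"
          by (simp add: play_kernel_def)
        then show ?case using neg Suc trap[of "h ! i" "h ! Suc i"] by auto
      qed
      then show False using \<open>h \<in> ?H\<close> by (auto simp: last_conv_nth)
    qed
    then have "emeasure ?M (?P h) = 0"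
      unfolding emeasure_play_measure_prefix by auto
    then show ?thesis by (auto simp: prefix_sets_play_measure)
  qed
  have "(\<Union>h\<in>?H. ?P h) \<in> null_sets ?M"
    by (intro null_sets_UN' null) auto
  moreover have "reaching G T \<subseteq> (\<Union>h\<in>?H. ?P h)"
  proof
    fix \<omega> assume "\<omega> \<in> reaching G T"
    then obtain k where "\<omega> k \<in> T" by (auto simp: reaching_def)
    then have "map \<omega> [0..<Suc k] \<in> ?H" using T by auto
    moreover have "\<omega> \<in> ?P (map \<omega> [0..<Suc k])"
      by (auto simp del: upt_Suc)
    ultimately show "\<omega> \<in> (\<Union>h\<in>?H. ?P h)" by blast
  qed
  ultimately have "emeasure ?M (reaching G T) \<le> 0"
    using emeasure_mono[of "reaching G T" "\<Union>h\<in>?H. ?P h" ?M]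
    by (simp only: null_setsD1 null_setsD2)
  then show ?thesis by simp
qed

section \<open>Every vertex of the game is transient\<close>

lemma pmf_embed_delta:
  assumes "stochastic_game G" "u \<in> VP G"
  shows "pmf (embed_pmf (delta G u)) a = delta G u a"
proof (rule pmf_embed_pmf)
  show "0 \<le> delta G u x" for x using assms by (auto simp: stochastic_game_def)
  have "(\<integral>\<^sup>+x. ennreal (delta G u x) \<partial>count_space UNIV) = (\<Sum>x\<in>UNIV. ennreal (delta G u x))"
    by (simp add: nn_integral_count_space_finite)
  also have "\<dots> = ennreal (\<Sum>x\<in>UNIV. delta G u x)"
    using assms by (intro sum_ennreal) (auto simp: stochastic_game_def)
  also have "\<dots> = 1" using assms by (auto simp: stochastic_game_def)
  finally show "(\<integral>\<^sup>+x. ennreal (delta G u x) \<partial>count_space UNIV) = 1" .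
qed

lemma set_pmf_next_vertex:
  assumes "stochastic_game G" "strategy1 G \<pi>1" "strategy2 G \<pi>2"
  shows "set_pmf (next_vertex G \<pi>1 \<pi>2 (h @ [u])) \<subseteq> post G u"
proof
  fix a assume a: "a \<in> set_pmf (next_vertex G \<pi>1 \<pi>2 (h @ [u]))"
  have "u \<in> VP G" if "u \<notin> V1 G" "u \<notin> V2 G"
    using assms(1) that by (auto simp: stochastic_game_def)
  then show "a \<in> post G u"
    using a assms(2,3) pmf_embed_delta[OF assms(1), of u a]
    by (auto simp: next_vertex_def strategy_for_def post_def simp flip: pmf_positive_iff
      split: if_splits)
qed

text \<open>Transience refers to the given \<open>\<pi>1\<close>, while the stopping assumption is
  applied to another Player 1 strategy \<open>\<sigma>\<close> against the same fair
  \<open>\<pi>2\<close>.\<close>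

lemma all_transient:
  fixes G :: "'v::finite game" and u :: 'v
  assumes G: "stochastic_game G"
    and stop: "stopping_under_fairness G"
    and p1: "strategy1 G \<pi>1"
    and p2: "strategy2 G \<pi>2" and mem: "memoryless (V2 G) \<pi>2" and fair: "fair2 G \<pi>2"
  shows "transient (next_vertex G \<pi>1 \<pi>2) (UNIV - terminals G) u"
proof -
  define K where "K = next_vertex G \<pi>1 \<pi>2"
  define S where "S = UNIV - terminals G"
  define B where "B = {u. transient K S u}"
  have supp: "set_pmf (K (h @ [u])) \<subseteq> post G u" for h u
    unfolding K_def using set_pmf_next_vertex[OF G p1 p2] .
  \<comment> \<open>A terminal has only itself as successor, so survival is 0 already at horizon
    1.\<close>
  have T: "terminals G \<subseteq> B"
  proof
    fix t assume t: "t \<in> terminals G"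
    then have "post G t = {t}"
      by (auto simp: terminals_def terminal_def post_def)
    then have "pmf (K (h @ [t])) a = 0" if "a \<in> S" for h a
      using supp[of h t] that t by (auto simp: S_def set_pmf_iff)
    then have "survival K S (Suc 0) (h @ [t]) \<le> 1 - 1" for h by simp
    then show "t \<in> B"
      unfolding B_def transient_def
      by (intro CollectI exI[of _ "Suc 0"] exI[of _ "1 :: real"] conjI allI zero_less_one)
  qed
  \<comment> \<open>Outside \<open>V1 G\<close> the kernel depends only on the current vertex, so
    its value at the single history \<open>h0\<close> serves as the uniform bound
    \<open>p\<close>.\<close>
  have step: "a \<in> B" if "a \<notin> V1 G" "b \<in> B" "b \<in> set_pmf (K (h0 @ [a]))" for a b h0
  proof -
    have eq: "K (h @ [a]) = K (h0 @ [a])" for h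
      using that(1) mem by (auto simp: K_def next_vertex_def memoryless_def)
    have "transient K S a"
    proof (rule transient_if_successor_transient)
      show "transient K S b" using that(2) by (simp add: B_def)
      show "pmf (K (h0 @ [a])) b > 0" using that(3) by (rule pmf_positive)
      show "pmf (K (h @ [a])) b \<ge> pmf (K (h0 @ [a])) b" for h by (simp only: eq[of h])
    qed
    then show ?thesis by (simp add: B_def)
  qed
  \<comment> \<open>\<open>\<sigma>\<close> moves to a successor outside \<open>B\<close> whenever
    there is one, and otherwise to an arbitrary successor so that it remains a legal
    strategy.\<close>
  define \<sigma> where "\<sigma> = (\<lambda>h :: 'v list. return_pmf
    (SOME b. b \<in> post G (last h) \<and> (post G (last h) \<subseteq> B \<or> b \<notin> B)))"
  have \<sigma>: "\<exists>b. \<sigma> (h @ [a]) = return_pmf b \<and> b \<in> post G a \<and> (post G a \<subseteq> B \<or> b \<notin> B)" for h a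
  proof -
    have "post G a \<noteq> {}"
      using G unfolding stochastic_game_def by blast
    then have "\<exists>b. b \<in> post G a \<and> (post G a \<subseteq> B \<or> b \<notin> B)"
      by blast
    from someI_ex[OF this] show ?thesis
      unfolding \<sigma>_def last_snoc by blast
  qed
  have s1: "strategy1 G \<sigma>"
    unfolding strategy_for_def
  proof (intro allI ballI impI)
    fix h a b assume "0 < pmf (\<sigma> (h @ [a])) b"
    then show "b \<in> post G a" using \<sigma>[of h a] by (auto simp: indicator_def split: if_splits)
  qed
  have trap: "pmf (next_vertex G \<sigma> \<pi>2 (h @ [a])) b = 0" if ab: "a \<notin> B" "b \<in> B" for h a b
  proof (cases "a \<in> V1 G")
    case True
    have "\<not> post G a \<subseteq> B"
      using transient_if_successors_transient[of "post G a" K S a] supp ab(1)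
      by (auto simp: B_def)
    then obtain c where "\<sigma> (h @ [a]) = return_pmf c" "c \<notin> B"
      using \<sigma>[of h a] by blast
    then show ?thesis
      using True ab(2) by (auto simp: next_vertex_def indicator_def)
  next
    case False
    \<comment> \<open>Replacing \<open>\<pi>1\<close> by \<open>\<sigma>\<close> changes moves at
      \<open>V1 G\<close> only, so \<open>step\<close> transfers.\<close>
    then have "next_vertex G \<sigma> \<pi>2 (h @ [a]) = K (h @ [a])"
      by (simp add: K_def next_vertex_def)
    then show ?thesis using step[OF False ab(2), of h] ab(1) by (auto simp: set_pmf_iff)
  qed
  have "u \<in> B"
  proof (rule ccontr)
    assume "u \<notin> B"
    then have "emeasure (play_measure G \<sigma> \<pi>2 u) (reaching G (terminals G)) = 0"
      using T trap by (rule reaching_null_if_trap)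
    moreover have "emeasure (play_measure G \<sigma> \<pi>2 u) (reaching G (terminals G)) = 1"
      using stop s1 p2 fair by (auto simp: stopping_under_fairness_def)
    ultimately show False by simp
  qed
  then show ?thesis by (simp add: B_def K_def S_def)
qed

section \<open>Comparison of the cylinder sums with survival\<close>

theorem theorem5:
  fixes G :: "'v::finite game" and \<pi>1 \<pi>2 :: "'v strategy" and v :: 'v
  assumes "stochastic_game G"
    and "stopping_under_fairness G"
    and "strategy1 G \<pi>1"
    and "strategy2 G \<pi>2" and "memoryless (V2 G) \<pi>2" and "fair2 G \<pi>2"
  shows "(\<Sum>N. \<Sum>h \<in> {v # w | w. length w = N \<and> set w \<subseteq> UNIV - terminals G}.
            emeasure (play_measure G \<pi>1 \<pi>2 v) (cylinder G h)) < \<infinity>"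
proof -
  let ?K = "next_vertex G \<pi>1 \<pi>2" and ?S = "UNIV - terminals G"
  let ?M = "play_measure G \<pi>1 \<pi>2 v"
  have le: "(\<Sum>h \<in> {v # w | w. length w = N \<and> set w \<subseteq> ?S}. emeasure ?M (cylinder G h))
      \<le> ennreal (survival ?K ?S N [v])" for N
  proof -
    let ?L = "{w. length w = N \<and> set w \<subseteq> ?S}"
    have "{v # w | w. length w = N \<and> set w \<subseteq> ?S} = (#) v ` ?L" by auto
    then have "(\<Sum>h \<in> {v # w | w. length w = N \<and> set w \<subseteq> ?S}. emeasure ?M (cylinder G h))
        = (\<Sum>w\<in>?L. emeasure ?M (cylinder G (v # w)))"
      by (simp add: sum.reindex)
    \<comment> \<open>A cylinder contains only sequences in \<open>paths G\<close>; dropping this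
      restriction gives a measurable prefix event of known probability.\<close>
    also have "\<dots> \<le> (\<Sum>w\<in>?L. emeasure ?M {\<omega>. \<forall>i < length (v # w). \<omega> i = (v # w) ! i})"
      by (intro sum_mono emeasure_mono prefix_sets_play_measure) (auto simp: cylinder_def)
    also have "\<dots> = (\<Sum>w\<in>?L. ennreal (\<Prod>i<N. pmf (?K ([v] @ take i w)) (w ! i)))"
      unfolding emeasure_play_measure_prefix_Cons by (intro sum.cong) auto
    also have "\<dots> = ennreal (survival ?K ?S N [v])"
      unfolding survival_eq_sum_prod by (intro sum_ennreal prod_nonneg) auto
    finally show ?thesis .
  qed
  have "(\<Sum>N. ennreal (survival ?K ?S N [v])) \<noteq> top"
    using summable_survival[OF all_transient[OF assms]] survival_nonneg
    by (intro ennreal_suminf_neq_top)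
  then have "(\<Sum>N. ennreal (survival ?K ?S N [v])) < \<infinity>"
    by (simp add: less_top)
  then show ?thesis
    by (rule le_less_trans[rotated]) (intro suminf_le le summableI)
qed

end
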